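(* Let $a,b,c$ be nonzero real numbers, let $w_0,w_1$ be arbitrary real initial values, and let $\{w_n\}$ be the associated generalized bi-periodic Horadam sequence. Then for every positive integer $n$, $$w_{n+1}^2-c^2w_{n-1}^2=a^{\zeta(n)}b^{\zeta(n+1)}\left(w_1w_{2n}+c\,w_0w_{2n-1}\right).$$
   Context: For nonzero real numbers $a,b,c$ and real initial values $w_0,w_1$, the generalized bi-periodic Horadam sequence $\{w_n\}$ is defined by $w_n=\chi(n)w_{n-1}+c\,w_{n-2}$ for $n\ge 2$, where $\chi(n)=a$ if $n$ is even and $\chi(n)=b$ if $n$ is odd. The parity function is $\zeta(n)=0$ if $n$ is even and $\zeta(n)=1$ if $n$ is odd. *)

theory Defs
  imports Complex_Main
begin

definition chi :: "real \<Rightarrow> real \<Rightarrow> nat \<Rightarrow> real" where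
  "chi a b n = (if even n then a else b)"

definition zeta :: "nat \<Rightarrow> nat" where
  "zeta n = (if even n then 0 else 1)"

fun horadam :: "real \<Rightarrow> real \<Rightarrow> real \<Rightarrow> real \<Rightarrow> real \<Rightarrow> nat \<Rightarrow> real" where
  "horadam a b c w0 w1 0 = w0"
| "horadam a b c w0 w1 (Suc 0) = w1"
| "horadam a b c w0 w1 (Suc (Suc n)) =
     chi a b (Suc (Suc n)) * horadam a b c w0 w1 (Suc n) + c * horadam a b c w0 w1 n"

end

(* With n = k + d, the expression w(k+1) w(k+2d) + c w(k) w(k+2d-1) depends only on n: raising k and
   lowering d by one leaves it unchanged, because the two indices k and k+2d have the same parity and
   so use the same coefficient in the recurrence. Moving from k = 0 to k = n gives
   w(n) (w(n+1) + c w(n-1)), and w(n+1) - c w(n-1) = chi(n+1) w(n) supplies the other factor of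
   the difference of squares. *)
theory Submission imports Defs begin

lemma horadam_step:
  assumes "n \<ge> 1"
  shows "horadam a b c w0 w1 (n + 1)
       = chi a b (n + 1) * horadam a b c w0 w1 n + c * horadam a b c w0 w1 (n - 1)"
  using assms by (cases n) auto

lemma horadam_convolution:
  fixes a b c w0 w1 :: real
  defines "w \<equiv> horadam a b c w0 w1"
  shows "w (k + 1) * w (k + 2 * d) + c * w k * w (k + 2 * d - 1)
       = w (k + d) * (w (k + d + 1) + c * w (k + d - 1))"
\<comment> \<open>\<open>k\<close> stays arbitrary because the case \<open>Suc d\<close> at
  \<open>k\<close> needs the hypothesis at \<open>k + 1\<close>.\<close>
proof (induction d arbitrary: k)
  case 0
  \<comment> \<open>Both sides contain the same \<open>w (k - 1)\<close>, so truncation at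
    \<open>k = 0\<close> does no harm.\<close>
  show ?case by (simp add: algebra_simps)
next
  case (Suc d)
  have "chi a b (k + 2 * d + 2) = chi a b (k + 2)"
    by (simp add: chi_def)
  \<comment> \<open>Expand \<open>w (k + 2 * d + 2)\<close>; the terms with factor
    \<open>w (k + 2 * d + 1)\<close> then recombine into \<open>w (k + 2)\<close>.\<close>
  then have "w (k + 1) * w (k + 2 * Suc d) + c * w k * w (k + 2 * Suc d - 1)
      = w (k + 2) * w (k + 1 + 2 * d) + c * w (k + 1) * w (k + 2 * d)"
    by (simp add: w_def algebra_simps)
  with Suc.IH[of "k + 1"] show ?case by simp
qed

theorem theorem6:
  fixes a b c w0 w1 :: real and w :: "nat \<Rightarrow> real" and n :: nat
  assumes "a \<noteq> 0" and "b \<noteq> 0" and "c \<noteq> 0"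
    and "w = horadam a b c w0 w1"
    and "n \<ge> 1"
  shows "(w (n + 1))\<^sup>2 - c\<^sup>2 * (w (n - 1))\<^sup>2
       = a ^ zeta n * b ^ zeta (n + 1) * (w 1 * w (2 * n) + c * w 0 * w (2 * n - 1))"
proof -
  \<comment> \<open>Exactly one exponent is 1: that of \<open>a\<close> for odd \<open>n\<close>,
    that of \<open>b\<close> for even \<open>n\<close>.\<close>
  have chi: "chi a b (n + 1) = a ^ zeta n * b ^ zeta (n + 1)"
    by (simp add: chi_def zeta_def)
  have diff: "w (n + 1) - c * w (n - 1) = chi a b (n + 1) * w n"
    using horadam_step[OF assms(5)] assms(4) by simp
  have "(w (n + 1))\<^sup>2 - c\<^sup>2 * (w (n - 1))\<^sup>2
      = (w (n + 1) - c * w (n - 1)) * (w (n + 1) + c * w (n - 1))"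
    by (simp add: power2_eq_square algebra_simps)
  also have "\<dots> = chi a b (n + 1) * (w n * (w (n + 1) + c * w (n - 1)))"
    by (simp only: diff mult.assoc)
  also have "w n * (w (n + 1) + c * w (n - 1)) = w 1 * w (2 * n) + c * w 0 * w (2 * n - 1)"
    using horadam_convolution[of a b c w0 w1 0 n] assms(4) by simp
  finally show ?thesis
    by (simp only: chi)
qed

end
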